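(* Let $k>0$, $\gamma>0$, $\kappa\in(0,1)$ and a positive integer $P$ be fixed, let $D=[0,1]^3$ and $N(x)=1/\gamma^3$. Let $n_0^2,n^2:D\to\mathbb{C}$ be the original and the desired refraction coefficients, let $p(x):=k^2[n_0^2(x)-n^2(x)]$, so that $n^2(x)=n_0^2(x)-k^{-2}p(x)$, and let $h(x):=\gamma^3p(x)/(4\pi)$, so that $p(x)=4\pi h(x)N(x)$. For each positive integer $m$ with $\gamma>[1/(2mP)]^{(\kappa+1)/3}$, let $a_{mP}\in(0,1/(mP))$ be the solution of $\frac{1}{mP}-2a_{mP}=\gamma a_{mP}^{(2-\kappa)/3}$, let $x_l$, $1\le l\le (mP)^3$, be the centers of the $(mP)^3$ cubes of side length $1/(mP)$ partitioning $D$ (equivalently, the centers of the embedded balls of radius $a_{mP}$), and define $$n_{a_{mP}}^2(x):=n_0^2(x)-k^{-2}p_{a_{mP}}(x),\qquad p_{a_{mP}}(x):=4\pi h(x)N(x)\left(\gamma mP\,a_{mP}^{(2-\kappa)/3}\right)^3 .$$ Then $$\max_{1\le l\le (mP)^3}\left|n^2(x_l)-n^2_{a_{mP}}(x_l)\right|\le k^{-2}\|p\|_\infty\left|1-\left(\gamma mP\,a_{mP}^{(2-\kappa)/3}\right)^3\right| .$$ Consequently, $$\lim_{m\to\infty}\ \max_{1\le l\le (mP)^3}\left|n^2(x_l)-n^2_{a_{mP}}(x_l)\right|=0 .$$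
   Context: $n_0^2$ and $n^2$ are Riemann integrable (in particular bounded) complex-valued functions on $D$ with nonnegative imaginary parts, and $h$ is continuous on $D$ with $\operatorname{Im}h\le0$. $\|p\|_\infty:=\sup_{x\in D}|p(x)|$. The notation $n^2$, $n_0^2$, $n^2_{a_{mP}}$ denotes the functions themselves (not necessarily squares of given functions). One ball of radius $a_{mP}$ is embedded at the centroid of each of the $(mP)^3$ cubes; the equation defining $a_{mP}$ has exactly one positive solution and says that the minimal distance between distinct balls is $\gamma a_{mP}^{(2-\kappa)/3}$. *)

theory Defs
  imports "HOL-Analysis.Analysis"
begin

abbreviation unit_cube :: "(real^3) set" where
  "unit_cube \<equiv> cbox 0 1"

text \<open>The integral provided by the library on euclidean spaces is the Henstock--Kurzweil integral.
  Restricting the gauges to constant ones, that is, bounding the mesh of the tagged divisions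
  uniformly, gives the Riemann integral; in particular, a Riemann integrable function is bounded.\<close>

definition riemann_integrable_on ::
    "('a::euclidean_space \<Rightarrow> 'b::real_normed_vector) \<Rightarrow> 'a set \<Rightarrow> bool"
    (infixr "riemann'_integrable'_on" 46) where
  "f riemann_integrable_on S \<longleftrightarrow>
     (\<exists>I. \<forall>e>0. \<exists>d>0. \<forall>T. T tagged_division_of S \<and> (\<forall>(x, K)\<in>T. diameter K < d) \<longrightarrow>
        norm ((\<Sum>(x, K)\<in>T. measure lborel K *\<^sub>R f x) - I) < e)"

definition sup_norm :: "(real^3 \<Rightarrow> complex) \<Rightarrow> real" where
  "sup_norm p = (SUP x\<in>unit_cube. cmod (p x))"

text \<open>The refraction coefficients are denoted n0sq and nsq: they are functions in their own right,
  not squares of given functions.\<close>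

definition p_fun :: "real \<Rightarrow> (real^3 \<Rightarrow> complex) \<Rightarrow> (real^3 \<Rightarrow> complex) \<Rightarrow> real^3 \<Rightarrow> complex" where
  "p_fun k n0sq nsq x = of_real (k\<^sup>2) * (n0sq x - nsq x)"

definition h_fun :: "real \<Rightarrow> (real^3 \<Rightarrow> complex) \<Rightarrow> real^3 \<Rightarrow> complex" where
  "h_fun \<gamma> p x = of_real (\<gamma> ^ 3) * p x / of_real (4 * pi)"

definition N_fun :: "real \<Rightarrow> real^3 \<Rightarrow> real" where
  "N_fun \<gamma> x = 1 / \<gamma> ^ 3"

text \<open>In the following, M is the number of small cubes along each edge of the unit cube.
  The defining equation of the radius says that neighbouring balls, centered at the centers of
  the small cubes, have distance \<^term>\<open>\<gamma> * a powr ((2 - \<kappa>) / 3)\<close>.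
  For positive \<^term>\<open>\<gamma>\<close>, positive M and \<^term>\<open>\<kappa>\<close> strictly between 0 and 1 it has
  exactly one solution in the given interval.\<close>

definition ball_radius :: "real \<Rightarrow> real \<Rightarrow> nat \<Rightarrow> real" where
  "ball_radius \<gamma> \<kappa> M =
     (THE a. 0 < a \<and> a < 1 / real M \<and> 1 / real M - 2 * a = \<gamma> * a powr ((2 - \<kappa>) / 3))"

definition grid_point :: "nat \<Rightarrow> (3 \<Rightarrow> nat) \<Rightarrow> real^3" where
  "grid_point M j = (\<chi> i. real (j i) / real M)"

text \<open>The small cubes are \<^term>\<open>cbox (grid_point M j) (grid_point M (\<lambda>i. Suc (j i)))\<close>.\<close>

definition cube_centers :: "nat \<Rightarrow> (real^3) set" where
  "cube_centers M =
     {midpoint (grid_point M j) (grid_point M (\<lambda>i. Suc (j i))) | j. \<forall>i. j i < M}"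

definition density_factor :: "real \<Rightarrow> real \<Rightarrow> nat \<Rightarrow> real" where
  "density_factor \<gamma> \<kappa> M = (\<gamma> * real M * ball_radius \<gamma> \<kappa> M powr ((2 - \<kappa>) / 3)) ^ 3"

definition p_approx ::
    "real \<Rightarrow> real \<Rightarrow> (real^3 \<Rightarrow> complex) \<Rightarrow> nat \<Rightarrow> real^3 \<Rightarrow> complex" where
  "p_approx \<gamma> \<kappa> h M x = of_real (4 * pi) * h x * of_real (N_fun \<gamma> x) * of_real (density_factor \<gamma> \<kappa> M)"

definition nsq_approx ::
    "real \<Rightarrow> real \<Rightarrow> real \<Rightarrow> (real^3 \<Rightarrow> complex) \<Rightarrow> (real^3 \<Rightarrow> complex) \<Rightarrow> nat \<Rightarrow> real^3 \<Rightarrow> complex" where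
  "nsq_approx k \<gamma> \<kappa> n0sq h M x = n0sq x - of_real (1 / k\<^sup>2) * p_approx \<gamma> \<kappa> h M x"

text \<open>There are \<^term>\<open>M ^ 3\<close> centers, hence they can be enumerated by \<^term>\<open>{1..M ^ 3}\<close>.\<close>

lemma card_cube_centers:
  assumes "M > 0"
  shows "finite (cube_centers M)" and "card (cube_centers M) = M ^ 3"
proof -
  let ?c = "\<lambda>j. midpoint (grid_point M j) (grid_point M (\<lambda>i. Suc (j i)))"
  let ?J = "PiE (UNIV :: 3 set) (\<lambda>_. {..<M})"
  have eq: "cube_centers M = ?c ` ?J"
    by (auto simp: cube_centers_def PiE_UNIV_domain)
  have c: "?c j $ i = (real (j i) + 1 / 2) / real M" for j i
    using assms by (simp add: midpoint_def grid_point_def field_simps)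
  have "inj ?c"
  proof (rule injI, rule ext)
    fix j j' :: "3 \<Rightarrow> nat" and i
    assume "?c j = ?c j'"
    hence "(real (j i) + 1 / 2) / real M = (real (j' i) + 1 / 2) / real M"
      by (metis c)
    thus "j i = j' i"
      using assms by simp
  qed
  hence "card (?c ` ?J) = card ?J"
    by (intro card_image) (auto intro: inj_on_subset)
  also have "card ?J = M ^ 3"
    by (simp add: card_PiE)
  finally show "card (cube_centers M) = M ^ 3"
    by (simp add: eq)
  show "finite (cube_centers M)"
    by (simp add: eq finite_PiE)
qed

lemma ex_enumeration_cube_centers:
  assumes "M > 0"
  shows "\<exists>x. bij_betw x {1..M ^ 3} (cube_centers M)"
  using card_cube_centers[OF assms] by (intro finite_same_card_bij) auto

end

theory Submission
  imports Defs
begin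

text \<open>
  The choice \<open>p = 4 * pi * h * N\<close> makes the approximate coefficient equal to the desired one
  up to a scalar: with \<open>F\<close> the density factor,
  \<open>nsq - nsq_approx = p * (F - 1) / k\<^sup>2\<close> at every point
  (\<open>nsq_diff_nsq_approx\<close>). So the error bound
  is the estimate of \<open>p\<close> by its supremum norm, which is finite because the continuous
  function \<open>h\<close>, a multiple of \<open>p\<close>, is bounded on the compact cube.

  For the limit, write \<open>a\<close> for the radius that belongs to \<open>M\<close> cubes per edge and
  \<open>s = (2 - \<kappa>) / 3\<close>. The defining equation of the radius says
  \<open>\<gamma> * M * a powr s = 1 - 2 * M * a\<close>, so \<open>F\<close> tends to 1 as soon as
  \<open>M * a\<close>, the ratio of the radius to the edge of a small cube, tends to 0. The same equation
  gives \<open>M * a powr s \<le> 1 / \<gamma>\<close>, and as \<open>s < 1\<close> the remaining factor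
  \<open>a powr (1 - s)\<close> of \<open>M * a\<close> tends to 0 with \<open>a < 1 / M\<close>
  (\<open>ball_radius_times_le\<close>, \<open>density_factor_tendsto_1\<close>). All this presupposes that
  the equation has exactly one solution, which follows from monotonicity and the intermediate value
  theorem (\<open>ex1_ball_radius\<close>).
\<close>

lemma ex1_ball_radius:
  fixes \<gamma> \<kappa> :: real
  assumes "\<gamma> > 0" "\<kappa> < 1" "M > 0"
  shows "\<exists>!a. 0 < a \<and> a < 1 / real M \<and> 1 / real M - 2 * a = \<gamma> * a powr ((2 - \<kappa>) / 3)"
proof -
  let ?s = "(2 - \<kappa>) / 3"
  \<comment> \<open>The equation reads \<open>f a = 1 / M\<close> for a strictly increasing continuous \<open>f\<close> with
    \<open>f 0 = 0\<close> and \<open>f (1 / M) > 1 / M\<close>.\<close>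
  define f where "f = (\<lambda>a. \<gamma> * a powr ?s + 2 * a)"
  have s: "?s > 0" using assms by simp
  have mono: "f a < f b" if "0 \<le> a" "a < b" for a b
    using that assms(1) s powr_less_mono2[of ?s a b] unfolding f_def
    by (intro add_strict_mono mult_strict_left_mono) auto
  have f0: "f 0 = 0" by (simp add: f_def)
  have f1: "f (1 / real M) > 1 / real M"
  proof -
    have "\<gamma> * (1 / real M) powr ?s \<ge> 0" "1 / real M > 0"
      using assms by simp_all
    then show ?thesis unfolding f_def by linarith
  qed
  have "continuous_on {0..1 / real M} f"
    unfolding f_def using s by (intro continuous_intros continuous_on_powr') auto
  then obtain a where a: "0 \<le> a" "a \<le> 1 / real M" "f a = 1 / real M"
    using IVT'[of f 0 "1 / real M" "1 / real M"] f0 f1 by auto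
  have "a \<noteq> 0" using a(3) f0 assms(3) by auto
  moreover have "a \<noteq> 1 / real M" using a(3) f1 by auto
  ultimately have "0 < a" "a < 1 / real M" using a by auto
  moreover have "b = a" if "0 < b" "f b = 1 / real M" for b
    using mono[of a b] mono[of b a] that a by (cases a b rule: linorder_cases) auto
  moreover have "1 / real M - 2 * b = \<gamma> * b powr ?s \<longleftrightarrow> f b = 1 / real M" for b
    unfolding f_def by linarith
  ultimately show ?thesis
    using a(3) by metis
qed

lemma ball_radius:
  fixes \<gamma> \<kappa> :: real
  assumes "\<gamma> > 0" "\<kappa> < 1" "M > 0"
  shows "0 < ball_radius \<gamma> \<kappa> M" "ball_radius \<gamma> \<kappa> M < 1 / real M"
    "1 / real M - 2 * ball_radius \<gamma> \<kappa> M = \<gamma> * ball_radius \<gamma> \<kappa> M powr ((2 - \<kappa>) / 3)"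
  using theI'[OF ex1_ball_radius[OF assms]] by (auto simp: ball_radius_def)

lemma density_factor_eq:
  fixes \<gamma> \<kappa> :: real
  assumes "\<gamma> > 0" "\<kappa> < 1" "M > 0"
  shows "density_factor \<gamma> \<kappa> M = (1 - 2 * (real M * ball_radius \<gamma> \<kappa> M)) ^ 3"
proof -
  have "\<gamma> * real M * ball_radius \<gamma> \<kappa> M powr ((2 - \<kappa>) / 3)
      = real M * (1 / real M - 2 * ball_radius \<gamma> \<kappa> M)"
    using ball_radius(3)[OF assms] by simp
  also have "\<dots> = 1 - 2 * (real M * ball_radius \<gamma> \<kappa> M)"
    using assms(3) by (simp add: field_simps)
  finally show ?thesis by (simp add: density_factor_def)
qed

text \<open>Splitting \<open>a = a powr s * a powr (1 - s)\<close> with \<open>s = (2 - \<kappa>) / 3\<close>, the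
  first factor is at most \<open>1 / (\<gamma> * M)\<close> by the defining equation and the second at most
  \<open>(1 / M) powr (1 - s)\<close>.\<close>

lemma ball_radius_times_le:
  fixes \<gamma> \<kappa> :: real
  assumes "\<gamma> > 0" "-1 < \<kappa>" "\<kappa> < 1" "M > 0"
  shows "real M * ball_radius \<gamma> \<kappa> M \<le> 1 / \<gamma> * (1 / real M) powr ((1 + \<kappa>) / 3)"
proof -
  define a where "a = ball_radius \<gamma> \<kappa> M"
  note a = ball_radius[OF assms(1,3,4), folded a_def]
  have "(2 - \<kappa>) / 3 + (1 + \<kappa>) / 3 = 1"
    by (simp add: field_simps)
  then have "a powr ((2 - \<kappa>) / 3) * a powr ((1 + \<kappa>) / 3) = a"
    using a(1) by (simp flip: powr_add)
  then have "real M * a = (real M * a powr ((2 - \<kappa>) / 3)) * a powr ((1 + \<kappa>) / 3)"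
    by (simp add: mult.assoc)
  also have "\<dots> \<le> (1 / \<gamma>) * (1 / real M) powr ((1 + \<kappa>) / 3)"
  proof (intro mult_mono)
    have "\<gamma> * a powr ((2 - \<kappa>) / 3) \<le> 1 / real M"
      using a by linarith
    then show "real M * a powr ((2 - \<kappa>) / 3) \<le> 1 / \<gamma>"
      using assms by (simp add: field_simps)
    show "a powr ((1 + \<kappa>) / 3) \<le> (1 / real M) powr ((1 + \<kappa>) / 3)"
      using a assms by (intro powr_mono2) auto
  qed (use assms in auto)
  finally show ?thesis by (simp add: a_def)
qed

lemma density_factor_tendsto_1:
  fixes \<gamma> \<kappa> :: real
  assumes "\<gamma> > 0" "-1 < \<kappa>" "\<kappa> < 1"
  shows "density_factor \<gamma> \<kappa> \<longlonglongrightarrow> 1"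
proof -
  have "(\<lambda>M. (1 / real M) powr ((1 + \<kappa>) / 3)) \<longlonglongrightarrow> 0 powr ((1 + \<kappa>) / 3)"
    using assms by (intro tendsto_powr' lim_1_over_n tendsto_const) auto
  then have "(\<lambda>M. 1 / \<gamma> * (1 / real M) powr ((1 + \<kappa>) / 3)) \<longlonglongrightarrow> 1 / \<gamma> * 0"
    by (intro tendsto_mult tendsto_const) simp
  then have bound: "(\<lambda>M. 1 / \<gamma> * (1 / real M) powr ((1 + \<kappa>) / 3)) \<longlonglongrightarrow> 0"
    by simp
  have "(\<lambda>M. real M * ball_radius \<gamma> \<kappa> M) \<longlonglongrightarrow> 0"
  proof (rule tendsto_sandwich[OF _ _ tendsto_const bound])
    show "\<forall>\<^sub>F M in sequentially. 0 \<le> real M * ball_radius \<gamma> \<kappa> M"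
      using eventually_gt_at_top[of 0]
      by eventually_elim (use ball_radius(1)[OF assms(1,3)] in \<open>auto intro: less_imp_le\<close>)
    show "\<forall>\<^sub>F M in sequentially.
        real M * ball_radius \<gamma> \<kappa> M \<le> 1 / \<gamma> * (1 / real M) powr ((1 + \<kappa>) / 3)"
      using eventually_gt_at_top[of 0]
      by eventually_elim (use ball_radius_times_le[OF assms] in auto)
  qed
  then have "(\<lambda>M. (1 - 2 * (real M * ball_radius \<gamma> \<kappa> M)) ^ 3) \<longlonglongrightarrow> (1 - 2 * 0) ^ 3"
    by (intro tendsto_intros)
  moreover have "\<forall>\<^sub>F M in sequentially.
      (1 - 2 * (real M * ball_radius \<gamma> \<kappa> M)) ^ 3 = density_factor \<gamma> \<kappa> M"
    using eventually_gt_at_top[of 0]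
    by eventually_elim (simp add: density_factor_eq[OF assms(1,3)])
  ultimately show ?thesis
    using Lim_transform_eventually by fastforce
qed

lemma cube_centers_subset_unit_cube: "cube_centers M \<subseteq> unit_cube"
proof
  fix y assume "y \<in> cube_centers M"
  then obtain j where y: "y = midpoint (grid_point M j) (grid_point M (\<lambda>i. Suc (j i)))"
    and j: "\<And>i. j i < M"
    by (auto simp: cube_centers_def)
  have "y $ i = (real (j i) + 1 / 2) / real M" for i
    using j[of i] by (simp add: y midpoint_def grid_point_def field_simps)
  moreover have "real (j i) + 1 / 2 \<le> real M" for i
    using j[of i] by linarith
  moreover have "real M > 0"
    using j[of undefined] by simp
  ultimately show "y \<in> unit_cube"
    by (auto simp: mem_box_cart)
qed

lemma norm_le_sup_norm:
  assumes "continuous_on unit_cube p" "y \<in> unit_cube"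
  shows "cmod (p y) \<le> sup_norm p"
  unfolding sup_norm_def
proof (rule cSUP_upper[OF assms(2)])
  have "compact ((\<lambda>x. cmod (p x)) ` unit_cube)"
    using assms(1) by (intro compact_continuous_image continuous_intros compact_cbox)
  then show "bdd_above ((\<lambda>x. cmod (p x)) ` unit_cube)"
    by (simp add: bounded_imp_bdd_above compact_imp_bounded)
qed

lemma nsq_diff_nsq_approx:
  assumes "k \<noteq> 0" "\<gamma> \<noteq> 0"
  shows "nsq y - nsq_approx k \<gamma> \<kappa> n0sq (h_fun \<gamma> (p_fun k n0sq nsq)) M y
    = of_real (1 / k\<^sup>2) * p_fun k n0sq nsq y * of_real (density_factor \<gamma> \<kappa> M - 1)"
proof -
  have "p_approx \<gamma> \<kappa> (h_fun \<gamma> (p_fun k n0sq nsq)) M y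
      = p_fun k n0sq nsq y * of_real (density_factor \<gamma> \<kappa> M)"
    using assms(2) by (simp add: p_approx_def h_fun_def N_fun_def)
  moreover have "nsq y = n0sq y - of_real (1 / k\<^sup>2) * p_fun k n0sq nsq y"
    using assms(1) by (simp add: p_fun_def)
  ultimately show ?thesis
    by (simp only: nsq_approx_def) (simp add: algebra_simps diff_divide_distrib)
qed

theorem theorem3p6:
  fixes k \<gamma> \<kappa> :: real and P :: nat
    and n0sq nsq p h :: "real^3 \<Rightarrow> complex"
    and x :: "nat \<Rightarrow> nat \<Rightarrow> real^3"
  defines "p \<equiv> p_fun k n0sq nsq"
    and "h \<equiv> h_fun \<gamma> p"
  assumes "k > 0" and "\<gamma> > 0" and "0 < \<kappa>" and "\<kappa> < 1" and "P > 0"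
    and "n0sq riemann_integrable_on unit_cube"
    and "nsq riemann_integrable_on unit_cube"
    and "\<And>y. y \<in> unit_cube \<Longrightarrow> Im (n0sq y) \<ge> 0"
    and "\<And>y. y \<in> unit_cube \<Longrightarrow> Im (nsq y) \<ge> 0"
    and "continuous_on unit_cube h"
    and "\<And>y. y \<in> unit_cube \<Longrightarrow> Im (h y) \<le> 0"
    and "\<And>m. m > 0 \<Longrightarrow> bij_betw (x m) {1..(m * P) ^ 3} (cube_centers (m * P))"
  shows "(\<forall>m>0. \<gamma> > (1 / (2 * real m * real P)) powr ((\<kappa> + 1) / 3) \<longrightarrow>
            (MAX l\<in>{1..(m * P) ^ 3}.
               cmod (nsq (x m l) - nsq_approx k \<gamma> \<kappa> n0sq h (m * P) (x m l)))
            \<le> 1 / k\<^sup>2 * sup_norm p *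
               \<bar>1 - (\<gamma> * real m * real P * ball_radius \<gamma> \<kappa> (m * P) powr ((2 - \<kappa>) / 3)) ^ 3\<bar>)
       \<and> (\<lambda>m. MAX l\<in>{1..(m * P) ^ 3}.
               cmod (nsq (x m l) - nsq_approx k \<gamma> \<kappa> n0sq h (m * P) (x m l)))
           \<longlonglongrightarrow> 0"
proof -
  have "(\<lambda>y. of_real (4 * pi / \<gamma> ^ 3) * h y) = p"
    using \<open>\<gamma> > 0\<close> by (auto simp: h_def h_fun_def)
  moreover have "continuous_on unit_cube (\<lambda>y. of_real (4 * pi / \<gamma> ^ 3) * h y)"
    using \<open>continuous_on unit_cube h\<close> by (intro continuous_intros)
  ultimately have "continuous_on unit_cube p"
    by (simp only:)
  note p_le = norm_le_sup_norm[OF this]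
  let ?err = "\<lambda>m l. cmod (nsq (x m l) - nsq_approx k \<gamma> \<kappa> n0sq h (m * P) (x m l))"
  let ?B = "\<lambda>m. 1 / k\<^sup>2 * sup_norm p * \<bar>1 - density_factor \<gamma> \<kappa> (m * P)\<bar>"
  have err_le: "?err m l \<le> ?B m" if "m > 0" "l \<in> {1..(m * P) ^ 3}" for m l
  proof -
    have "x m l \<in> cube_centers (m * P)"
      using \<open>\<And>m. m > 0 \<Longrightarrow> bij_betw (x m) {1..(m * P) ^ 3} (cube_centers (m * P))\<close>[OF that(1)] that(2)
      by (auto simp: bij_betw_def)
    then have "cmod (p (x m l)) \<le> sup_norm p"
      using cube_centers_subset_unit_cube by (intro p_le) auto
    moreover have "?err m l
        = 1 / k\<^sup>2 * cmod (p (x m l)) * \<bar>1 - density_factor \<gamma> \<kappa> (m * P)\<bar>"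
      using \<open>k > 0\<close> \<open>\<gamma> > 0\<close> unfolding h_def p_def
      by (subst nsq_diff_nsq_approx) (simp_all only: norm_mult norm_of_real, simp_all add: abs_minus_commute)
    ultimately show ?thesis
      by (auto intro!: mult_right_mono divide_right_mono)
  qed
  have ne: "{1..(m * P) ^ 3} \<noteq> {}" if "m > 0" for m
    using that \<open>P > 0\<close> by (auto simp: Suc_le_eq)
  have max_le: "(MAX l\<in>{1..(m * P) ^ 3}. ?err m l) \<le> ?B m" if "m > 0" for m
    using err_le[OF that] ne[OF that] by (subst Max_le_iff) auto
  have max_ge: "0 \<le> (MAX l\<in>{1..(m * P) ^ 3}. ?err m l)" if "m > 0" for m
    using ne[OF that] by (subst Max_ge_iff) auto
  have "filterlim (\<lambda>m. m * P) sequentially sequentially"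
    using \<open>P > 0\<close> by (intro filterlim_subseq) (simp add: strict_mono_def)
  then have "(\<lambda>m. density_factor \<gamma> \<kappa> (m * P)) \<longlonglongrightarrow> 1"
    by (rule filterlim_compose[rotated])
      (use \<open>\<gamma> > 0\<close> \<open>0 < \<kappa>\<close> \<open>\<kappa> < 1\<close> in \<open>simp add: density_factor_tendsto_1\<close>)
  then have "?B \<longlonglongrightarrow> 1 / k\<^sup>2 * sup_norm p * \<bar>1 - 1\<bar>"
    by (intro tendsto_intros)
  then have B: "?B \<longlonglongrightarrow> 0" by simp
  have "(\<lambda>m. MAX l\<in>{1..(m * P) ^ 3}. ?err m l) \<longlonglongrightarrow> 0"
    by (rule tendsto_sandwich[OF _ _ tendsto_const B])
      (use max_le max_ge in \<open>auto intro!: eventually_sequentiallyI[of 1] simp del: of_nat_mult\<close>)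
  moreover have "density_factor \<gamma> \<kappa> (m * P)
      = (\<gamma> * real m * real P * ball_radius \<gamma> \<kappa> (m * P) powr ((2 - \<kappa>) / 3)) ^ 3" for m
    by (simp add: density_factor_def mult.assoc)
  ultimately show ?thesis
    using max_le by simp
qed

end
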